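(* Let $n$ and $t$ be positive integers and let $m_1\geq m_2\geq\cdots\geq m_t\geq 2$ be integers. Let $F_1=2K_{1,n}$ and $F_2=\bigsqcup_{i=1}^t K_{1,m_i}$. Then $$\hat{r}(F_1,F_2)=n+m_1-1+\sum_{i=1}^{t}(n+m_i-1).$$
   Context: All graphs are undirected, simple, finite and without isolated vertices. $K_{1,n}$ is the star with one root vertex joined to $n$ leaves. $\sqcup$ denotes disjoint union of graphs, and $2K_{1,n}$ is the disjoint union of two copies of $K_{1,n}$. For graphs $F_1,F_2,G$, write $G\rightarrow(F_1,F_2)$ if for every coloring of the edges of $G$ by red and blue there is either a red copy of $F_1$ or a blue copy of $F_2$ in $G$ (copies are subgraphs, not necessarily induced). The size Ramsey number $\hat{r}(F_1,F_2)$ is the minimum number of edges of a graph $G$ such that $G\rightarrow(F_1,F_2)$. *)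

theory Defs
  imports Main
begin

text \<open>
  Since graphs have no isolated vertices, a graph is represented by its edge set; its vertex
  set is the union of its edges.
\<close>

definition simple_graph :: "'a set set \<Rightarrow> bool" where
  "simple_graph G \<longleftrightarrow> finite G \<and> (\<forall>e\<in>G. card e = 2)"

abbreviation vertices :: "'a set set \<Rightarrow> 'a set" where
  "vertices G \<equiv> \<Union>G"

text \<open>The star \<open>K\<^bsub>1,n\<^esub>\<close> with root \<open>0\<close> and leaves \<open>1, \<dots>, n\<close>.\<close>

definition star :: "nat \<Rightarrow> nat set set" where
  "star n = (\<lambda>j. {0, j}) ` {1..n}"

text \<open>Vertices of the \<open>i\<close>-th summand are tagged with \<open>i\<close> to make the summands disjoint.\<close>

definition disjoint_union :: "'i set \<Rightarrow> ('i \<Rightarrow> 'a set set) \<Rightarrow> ('i \<times> 'a) set set" where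
  "disjoint_union I G = (\<Union>i\<in>I. (\<lambda>e. Pair i ` e) ` G i)"

text \<open>Subgraph containment, not necessarily induced.\<close>

definition contains_copy :: "'a set set \<Rightarrow> 'b set set \<Rightarrow> bool" where
  "contains_copy G F \<longleftrightarrow> (\<exists>f. inj_on f (vertices F) \<and> (\<forall>e\<in>F. f ` e \<in> G))"

datatype colour = Red | Blue

definition arrows :: "'a set set \<Rightarrow> 'b set set \<Rightarrow> 'c set set \<Rightarrow> bool" where
  "arrows G F1 F2 \<longleftrightarrow>
    (\<forall>c :: 'a set \<Rightarrow> colour.
      contains_copy {e \<in> G. c e = Red} F1 \<or> contains_copy {e \<in> G. c e = Blue} F2)"

text \<open>
  Host graphs range over graphs with vertices in \<open>nat\<close>, which covers all finite graphs up to
  isomorphism.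
\<close>

definition size_ramsey :: "'b set set \<Rightarrow> 'c set set \<Rightarrow> nat" where
  "size_ramsey F1 F2 =
    (LEAST k. \<exists>G :: nat set set. simple_graph G \<and> arrows G F1 F2 \<and> card G = k)"

lemma simple_graph_star: "simple_graph (star n)"
  by (auto simp: simple_graph_def star_def)

lemma simple_graph_disjoint_union:
  assumes "finite I" and "\<And>i. i \<in> I \<Longrightarrow> simple_graph (G i)"
  shows "simple_graph (disjoint_union I G)"
  using assms by (auto simp: simple_graph_def disjoint_union_def card_image inj_on_def)

end

theory Submission
  imports Defs "HOL-Library.Disjoint_Sets" "HOL-Library.Nat_Bijection"
begin

text \<open>
  Write \<open>n = a + 1\<close>, so that the claimed value is \<open>(a + m\<^sub>1) + (\<Sum>i. a + m\<^sub>i)\<close>.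

  Upper bound: the disjoint union of the stars with \<open>a + m\<^sub>1\<close> and
  \<open>a + m\<^sub>1, \<dots>, a + m\<^sub>t\<close> edges arrows. If there is no red \<open>2K\<^bsub>1,n\<^esub>\<close>, then at most one of these
  stars has \<open>n\<close> red edges; every other one has at least \<open>m\<^sub>i\<close> blue edges, and the additional star
  of size \<open>a + m\<^sub>1\<close> can take the place of the exceptional one because \<open>m\<^sub>1\<close> is the largest \<open>m\<^sub>i\<close>.

  Lower bound: a graph \<open>G\<close> with fewer edges has a colouring without red \<open>2K\<^bsub>1,a+1\<^esub>\<close> and without blue
  \<open>F\<^sub>2\<close>, by induction on \<open>a\<close>. For \<open>a = 0\<close>, colour red the edges at a vertex of degree at least
  \<open>m\<^sub>1\<close>, if there is one; too few edges remain for \<open>F\<^sub>2\<close>. If there is none, colour everything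
  blue. For \<open>a > 0\<close> there are three cases. If
  \<open>F\<^sub>2\<close> is not contained in \<open>G\<close>, colour everything blue. If \<open>G\<close> has a matching \<open>M\<close> with \<open>t + 1\<close>
  edges, colour \<open>M\<close> red and \<open>G - M\<close> by induction: the bound for \<open>a\<close> drops by exactly \<open>t + 1\<close>, and
  a star loses at most one edge when \<open>M\<close> is deleted. Finally, let \<open>G\<close> contain \<open>F\<^sub>2\<close>, with set of
  roots \<open>X\<close>, but no matching of size \<open>t + 1\<close>. Since every root has two leaves, an edge \<open>e\<close> avoiding
  \<open>X\<close> extends to a matching of size \<open>t + 1\<close> (join every root to a leaf outside \<open>e\<close>), unless \<open>e\<close>
  consists of two chosen leaves of one root. Such edges are pairwise disjoint, so \<open>X\<close> meets every
  star with two edges (lemma \<open>roots_meet_star_if_no_large_matching\<close>). Colouring the edges at one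
  root red therefore leaves \<open>t - 1\<close> vertices that meet all blue stars with two edges, and there
  are no \<open>t\<close> disjoint ones.
\<close>

section \<open>Packings of stars\<close>

text \<open>
  An edge set \<open>E\<close> contains vertex-disjoint stars indexed by \<open>I\<close>, the \<open>i\<close>-th one with at least
  \<open>k i\<close> leaves; \<open>r\<close> gives the roots and \<open>L\<close> the leaf sets.
\<close>

definition is_star_packing ::
  "'a set set \<Rightarrow> 'i set \<Rightarrow> ('i \<Rightarrow> nat) \<Rightarrow> ('i \<Rightarrow> 'a) \<Rightarrow> ('i \<Rightarrow> 'a set) \<Rightarrow> bool" where
  "is_star_packing E I k r L \<longleftrightarrow>
     (\<forall>i\<in>I. finite (L i) \<and> k i \<le> card (L i) \<and> r i \<notin> L i \<and> (\<forall>l\<in>L i. {r i, l} \<in> E)) \<and>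
     disjoint_family_on (\<lambda>i. insert (r i) (L i)) I"

lemma is_star_packingD:
  assumes "is_star_packing E I k r L" "i \<in> I"
  shows "finite (L i)" "k i \<le> card (L i)" "r i \<notin> L i" "\<And>l. l \<in> L i \<Longrightarrow> {r i, l} \<in> E"
  using assms by (auto simp: is_star_packing_def)

lemma is_star_packing_disjoint:
  assumes "is_star_packing E I k r L" "i \<in> I" "j \<in> I"
    "x \<in> insert (r i) (L i)" "x \<in> insert (r j) (L j)"
  shows "i = j"
  using assms unfolding is_star_packing_def disjoint_family_on_def by blast

lemma edge_in_star_forest:
  assumes "i \<in> I" "j \<in> {1..k i}"
  shows "{(i, 0), (i, j)} \<in> disjoint_union I (\<lambda>i. star (k i))"
proof -
  have "{0, j} \<in> star (k i)" using assms(2) unfolding star_def by (rule imageI)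
  then have "Pair i ` {0, j} \<in> disjoint_union I (\<lambda>i. star (k i))"
    using assms(1) unfolding disjoint_union_def by blast
  then show ?thesis by simp
qed

text \<open>
  The stars need at least one edge here: \<open>star 0\<close> is empty, so that its root is not a vertex.
\<close>

lemma vertices_star_forest:
  assumes "\<And>i. i \<in> I \<Longrightarrow> k i \<ge> 1"
  shows "vertices (disjoint_union I (\<lambda>i. star (k i))) = (SIGMA i:I. {0..k i})"
proof (intro equalityI subsetI)
  fix x assume "x \<in> vertices (disjoint_union I (\<lambda>i. star (k i)))"
  then show "x \<in> (SIGMA i:I. {0..k i})"
    by (auto simp: disjoint_union_def star_def)
next
  fix x assume "x \<in> (SIGMA i:I. {0..k i})"
  then obtain i j where x: "x = (i, j)" "i \<in> I" "j \<le> k i" by auto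
  define j' where "j' = (if j = 0 then 1 else j)"
  have "{(i, 0), (i, j')} \<in> disjoint_union I (\<lambda>i. star (k i))"
    using x assms[of i] by (intro edge_in_star_forest) (auto simp: j'_def)
  moreover have "x \<in> {(i, 0), (i, j')}"
    by (auto simp: x j'_def)
  ultimately show "x \<in> vertices (disjoint_union I (\<lambda>i. star (k i)))" by blast
qed

lemma contains_copy_star_forest_iff:
  assumes "\<And>i. i \<in> I \<Longrightarrow> k i \<ge> 1"
  shows "contains_copy E (disjoint_union I (\<lambda>i. star (k i))) \<longleftrightarrow> (\<exists>r L. is_star_packing E I k r L)"
    (is "?C \<longleftrightarrow> ?P")
proof -
  have V: "vertices (disjoint_union I (\<lambda>i. star (k i))) = (SIGMA i:I. {0..k i})"
    using assms by (rule vertices_star_forest)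
  show ?thesis
  proof
    assume ?C
    then obtain f where f: "inj_on f (SIGMA i:I. {0..k i})"
      and fE: "\<forall>e\<in>disjoint_union I (\<lambda>i. star (k i)). f ` e \<in> E"
      unfolding contains_copy_def V by blast
    define r where "r i = f (i, 0)" for i
    define L where "L i = (\<lambda>j. f (i, j)) ` {1..k i}" for i
    have eq: "p = q" if "f p = f q" "p \<in> (SIGMA i:I. {0..k i})" "q \<in> (SIGMA i:I. {0..k i})" for p q
      using f that by (auto dest: inj_onD)
    have "is_star_packing E I k r L"
      unfolding is_star_packing_def
    proof (intro conjI ballI)
      fix i assume i: "i \<in> I"
      show "finite (L i)" by (simp add: L_def)
      have "inj_on (\<lambda>j. f (i, j)) {1..k i}"
        by (rule inj_onI) (use eq i in fastforce)
      then show "k i \<le> card (L i)" by (simp add: L_def card_image)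
      show "r i \<notin> L i" using eq i by (fastforce simp: r_def L_def)
      fix l assume "l \<in> L i"
      then obtain j where j: "l = f (i, j)" "j \<in> {1..k i}" by (auto simp: L_def)
      have "f ` {(i, 0), (i, j)} \<in> E"
        using fE edge_in_star_forest[OF i, of j k] j(2) by blast
      then show "{r i, l} \<in> E" by (simp add: r_def j)
    next
      have "{0..k i} = insert 0 {1..k i}" for i by auto
      then have "insert (r i) (L i) = (\<lambda>j. f (i, j)) ` {0..k i}" for i
        by (simp add: r_def L_def)
      moreover have "f ` Pair i ` {0..k i} \<inter> f ` Pair i' ` {0..k i'} = {}"
        if "i \<in> I" "i' \<in> I" "i \<noteq> i'" for i i'
        using that by (auto dest!: eq)
      ultimately show "disjoint_family_on (\<lambda>i. insert (r i) (L i)) I"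
        by (auto simp: disjoint_family_on_def image_image)
    qed
    then show ?P by blast
  next
    assume ?P
    then obtain r L where P: "is_star_packing E I k r L" by blast
    have "\<exists>h. inj_on h {1..k i} \<and> h ` {1..k i} \<subseteq> L i" if "i \<in> I" for i
      using is_star_packingD(1,2)[OF P that] card_le_inj[of "{1..k i}" "L i"] by auto
    then obtain h where h: "\<And>i. i \<in> I \<Longrightarrow> inj_on (h i) {1..k i}"
      "\<And>i. i \<in> I \<Longrightarrow> h i ` {1..k i} \<subseteq> L i" by metis
    define f where "f = (\<lambda>(i, j). if j = 0 then r i else h i j)"
    have f_in: "f (i, j) \<in> insert (r i) (L i)" if "i \<in> I" "j \<le> k i" for i j
      using h(2)[OF that(1)] that by (auto simp: f_def image_subset_iff)
    show ?C
      unfolding contains_copy_def V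
    proof (intro exI[of _ f] conjI ballI inj_onI)
      fix p q assume p: "p \<in> (SIGMA i:I. {0..k i})" and q: "q \<in> (SIGMA i:I. {0..k i})"
        and "f p = f q"
      obtain i j i' j' where ij: "p = (i, j)" "q = (i', j')" by fastforce
      have in_I: "i \<in> I" "j \<le> k i" "i' \<in> I" "j' \<le> k i'" using p q ij by auto
      have "f (i, j) \<in> insert (r i') (L i')"
        using f_in[OF in_I(3,4)] \<open>f p = f q\<close> ij by simp
      then have i: "i = i'" "i \<in> I"
        using is_star_packing_disjoint[OF P in_I(1,3) f_in[OF in_I(1,2)]] in_I(1) by blast+
      have "h i l \<noteq> r i" if "l \<in> {1..k i}" for l
        using h(2)[OF i(2)] is_star_packingD(3)[OF P i(2)] that by force
      moreover have "j \<in> {1..k i}" if "j \<noteq> 0" using that in_I by simp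
      moreover have "j' \<in> {1..k i}" if "j' \<noteq> 0" using that in_I i by simp
      moreover have "f (i, j) = f (i, j')" using \<open>f p = f q\<close> ij i by simp
      ultimately have "j = j'"
        using inj_onD[OF h(1)[OF i(2)], of j j'] unfolding f_def
        by (cases "j = 0"; cases "j' = 0") fastforce+
      then show "p = q" using ij i by simp
    next
      fix e assume "e \<in> disjoint_union I (\<lambda>i. star (k i))"
      then obtain i j where "i \<in> I" "j \<in> {1..k i}" "e = Pair i ` {0, j}"
        by (auto simp: disjoint_union_def star_def)
      then show "f ` e \<in> E"
        using is_star_packingD(4)[OF P, of i "h i j"] h(2)[of i]
        by (auto simp: f_def image_subset_iff)
    qed
  qed
qed

lemma sum_le_card_if_star_packing:
  assumes P: "is_star_packing E I k r L" and fin: "finite E" "finite I"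
  shows "(\<Sum>i\<in>I. k i) \<le> card E"
proof -
  define S where "S i = (\<lambda>l. {r i, l}) ` L i" for i
  have "card (S i) = card (L i)" for i
    unfolding S_def by (rule card_image) (auto simp: inj_on_def doubleton_eq_iff)
  then have "(\<Sum>i\<in>I. k i) \<le> (\<Sum>i\<in>I. card (S i))"
    using is_star_packingD(2)[OF P] by (auto intro: sum_mono)
  also have "\<dots> = card (\<Union>i\<in>I. S i)"
  proof (rule card_UN_disjoint[symmetric])
    show "\<forall>i\<in>I. finite (S i)" using is_star_packingD(1)[OF P] by (simp add: S_def)
    show "\<forall>i\<in>I. \<forall>j\<in>I. i \<noteq> j \<longrightarrow> S i \<inter> S j = {}"
      using is_star_packing_disjoint[OF P] by (auto simp: S_def doubleton_eq_iff)
  qed (rule fin)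
  also have "\<dots> \<le> card E"
    using is_star_packingD(4)[OF P] by (intro card_mono fin) (auto simp: S_def)
  finally show ?thesis .
qed

lemma no_two_stars_through_vertex:
  assumes "\<And>e. e \<in> E \<Longrightarrow> v \<in> e" and "k \<ge> 1"
  shows "\<not> is_star_packing E {1..2::nat} (\<lambda>_. k) r L"
proof
  assume P: "is_star_packing E {1..2::nat} (\<lambda>_. k) r L"
  have "v \<in> insert (r i) (L i)" if i: "i \<in> {1..2}" for i
  proof -
    have "card (L i) \<noteq> 0" using is_star_packingD(2)[OF P i] assms(2) by linarith
    then obtain l where "l \<in> L i" by fastforce
    then show ?thesis using assms(1) is_star_packingD(4)[OF P i] by blast
  qed
  then have "(1::nat) = 2" using is_star_packing_disjoint[OF P, of 1 2 v] by simp
  then show False by simp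
qed

lemma is_star_packing_delete_matching:
  assumes P: "is_star_packing E I (\<lambda>i. Suc (k i)) r L"
    and M: "\<And>e f. e \<in> M \<Longrightarrow> f \<in> M \<Longrightarrow> e \<noteq> f \<Longrightarrow> e \<inter> f = {}"
  shows "\<exists>L'. is_star_packing (E - M) I k r L'"
proof
  define L' where "L' i = L i - {l. {r i, l} \<in> M}" for i
  show "is_star_packing (E - M) I k r L'"
    unfolding is_star_packing_def
  proof (intro conjI ballI)
    fix i assume i: "i \<in> I"
    note Pi = is_star_packingD[OF P i]
    show "finite (L' i)" "r i \<notin> L' i" using Pi by (auto simp: L'_def)
    show "{r i, l} \<in> E - M" if "l \<in> L' i" for l using that Pi by (auto simp: L'_def)
    \<comment> \<open>at most one edge at the root belongs to the matching\<close>
    have "\<exists>l. {l. {r i, l} \<in> M} \<subseteq> {l}"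
    proof (cases "\<exists>l. {r i, l} \<in> M")
      case True
      then obtain l where "{r i, l} \<in> M" by blast
      then have "{l. {r i, l} \<in> M} \<subseteq> {l}"
        using M[of "{r i, l}"] by (fastforce simp: doubleton_eq_iff)
      then show ?thesis by blast
    qed auto
    then obtain l where "L i - {l} \<subseteq> L' i" by (auto simp: L'_def)
    then have "card (L i - {l}) \<le> card (L' i)"
      using \<open>finite (L' i)\<close> by (rule card_mono[rotated])
    then show "k i \<le> card (L' i)"
      using Pi(2) card_Diff_singleton_if[of "L i" l] by (auto split: if_splits)
  next
    show "disjoint_family_on (\<lambda>i. insert (r i) (L' i)) I"
      using P unfolding is_star_packing_def disjoint_family_on_def L'_def by fast
  qed
qed

section \<open>The lower bound\<close>

text \<open>
  The roots of a packing of as many stars as a maximum matching has edges, each star with two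
  leaves, form a transversal of all stars with two edges.
\<close>

lemma roots_meet_star_if_no_large_matching:
  assumes G: "simple_graph G" and fin: "finite I"
    and P: "is_star_packing G I k r L" and k: "\<And>i. i \<in> I \<Longrightarrow> k i \<ge> 2"
    and no_matching: "\<not> (\<exists>M\<subseteq>G. card M = Suc (card I) \<and>
          (\<forall>e\<in>M. \<forall>f\<in>M. e \<noteq> f \<longrightarrow> e \<inter> f = {}))"
    and star: "{q, p} \<in> G" "{q, s} \<in> G" "p \<noteq> s"
  shows "{q, p, s} \<inter> r ` I \<noteq> {}"
proof
  assume avoid: "{q, p, s} \<inter> r ` I = {}"
  have "\<exists>u v. u \<in> L i \<and> v \<in> L i \<and> u \<noteq> v" if "i \<in> I" for i
  proof -
    have "1 < card (L i)"
      using is_star_packingD(2)[OF P that] k[OF that] by linarith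
    then show ?thesis
      by (metis One_nat_def card_le_Suc0_iff_eq card.infinite linorder_not_le not_less_zero)
  qed
  then obtain u v where uv: "\<And>i. i \<in> I \<Longrightarrow> u i \<in> L i \<and> v i \<in> L i \<and> u i \<noteq> v i" by metis
  have leaves: "\<exists>i\<in>I. e = {u i, v i}" if e: "e \<in> G" "e \<inter> r ` I = {}" for e
  proof (rule ccontr)
    assume neq: "\<not> (\<exists>i\<in>I. e = {u i, v i})"
    have e2: "card e = 2" "finite e"
      using G e(1) by (auto simp: simple_graph_def intro: card_ge_0_finite)
    \<comment> \<open>\<open>e\<close> has two elements and is not \<open>{u i, v i}\<close>, so every root can be matched to a leaf outside \<open>e\<close>\<close>
    have "\<exists>w\<in>L i. w \<notin> e" if "i \<in> I" for i
    proof (rule ccontr)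
      assume "\<not> (\<exists>w\<in>L i. w \<notin> e)"
      then have "{u i, v i} \<subseteq> e" using uv[OF that] by blast
      then have "{u i, v i} = e" by (rule card_subset_eq[OF e2(2)]) (use e2 uv[OF that] in simp)
      then show False using neq that by blast
    qed
    then obtain w where w: "\<And>i. i \<in> I \<Longrightarrow> w i \<in> L i \<and> w i \<notin> e" by metis
    define N where "N = (\<lambda>i. {r i, w i}) ` I"
    have disj: "i = j" if ij: "i \<in> I" "j \<in> I" and ne: "{r i, w i} \<inter> {r j, w j} \<noteq> {}" for i j
    proof -
      obtain x where "x \<in> {r i, w i}" "x \<in> {r j, w j}" using ne by blast
      then show ?thesis
        using is_star_packing_disjoint[OF P ij, of x] w[OF ij(1)] w[OF ij(2)] by auto
    qed
    have "inj_on (\<lambda>i. {r i, w i}) I"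
      by (rule inj_onI) (use disj in blast)
    then have "card N = card I" by (simp add: N_def card_image)
    moreover have "e \<notin> N" "\<forall>f\<in>N. e \<inter> f = {}"
      using e(2) w by (auto simp: N_def)
    moreover have "insert e N \<subseteq> G"
      using e(1) w is_star_packingD(4)[OF P] by (auto simp: N_def)
    moreover have "\<forall>f\<in>N. \<forall>g\<in>N. f \<noteq> g \<longrightarrow> f \<inter> g = {}"
      unfolding N_def using disj by blast
    ultimately have "insert e N \<subseteq> G \<and> card (insert e N) = Suc (card I) \<and>
        (\<forall>f\<in>insert e N. \<forall>g\<in>insert e N. f \<noteq> g \<longrightarrow> f \<inter> g = {})"
      using fin by (auto simp: N_def)
    then show False using no_matching by blast
  qed
  obtain i where i: "i \<in> I" "{q, p} = {u i, v i}" using leaves[OF star(1)] avoid by blast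
  obtain j where j: "j \<in> I" "{q, s} = {u j, v j}" using leaves[OF star(2)] avoid by blast
  have "q \<in> L i" "q \<in> L j" using i j uv[OF i(1)] uv[OF j(1)] by (auto simp: doubleton_eq_iff)
  then have "i = j" using is_star_packing_disjoint[OF P i(1) j(1), of q] by blast
  then show False using i(2) j(2) star(3) by (auto simp: doubleton_eq_iff)
qed

text \<open>
  The weights \<open>m i\<close> need not be ordered: any \<open>i0 \<in> I\<close> can play the role of the largest star.
  For \<open>a = 0\<close> it supplies the degree threshold, and if there is no large matching, its root
  is the centre of the red star.
\<close>

lemma star_packing_free_colouring:
  fixes G :: "'a set set"
  assumes "simple_graph G" and fin: "finite I" and i0: "i0 \<in> I"
    and m: "\<And>i. i \<in> I \<Longrightarrow> m i \<ge> 2"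
    and "card G < a + m i0 + (\<Sum>i\<in>I. a + m i)"
  shows "\<exists>c. (\<nexists>r L. is_star_packing {e \<in> G. c e = Red} {1..2::nat} (\<lambda>_. Suc a) r L) \<and>
             (\<nexists>r L. is_star_packing {e \<in> G. c e = Blue} I m r L)"
  using assms(1,5)
proof (induction a arbitrary: G)
  case (0 G)
  then have finG: "finite G" by (simp add: simple_graph_def)
  show ?case
  proof (cases "\<exists>v. m i0 \<le> card {e \<in> G. v \<in> e}")
    case True
    then obtain v where v: "m i0 \<le> card {e \<in> G. v \<in> e}" by blast
    define c where "c e = (if v \<in> e then Red else Blue)" for e
    have split: "card G = card {e \<in> G. v \<in> e} + card {e \<in> G. v \<notin> e}"
      using finG by (subst card_Un_disjoint[symmetric]) (auto intro: arg_cong[where f = card])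
    have blue: "{e \<in> G. c e = Blue} = {e \<in> G. v \<notin> e}" by (auto simp: c_def)
    have "\<not> is_star_packing {e \<in> G. c e = Blue} I m r L" for r L
      using sum_le_card_if_star_packing[of "{e \<in> G. c e = Blue}" I m r L] split 0(2) v finG fin
      unfolding blue by auto
    moreover have "\<not> is_star_packing {e \<in> G. c e = Red} {1..2::nat} (\<lambda>_. Suc 0) r L" for r L
      by (rule no_two_stars_through_vertex[where v = v]) (auto simp: c_def split: if_splits)
    ultimately show ?thesis by blast
  next
    case False
    have "\<not> is_star_packing G I m r L" for r L
    proof
      assume P: "is_star_packing G I m r L"
      have "card (L i0) = card ((\<lambda>l. {r i0, l}) ` L i0)"
        by (rule card_image[symmetric]) (auto simp: inj_on_def doubleton_eq_iff)
      also have "\<dots> \<le> card {e \<in> G. r i0 \<in> e}"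
        using is_star_packingD(4)[OF P i0] finG by (intro card_mono) auto
      finally show False using False is_star_packingD(2)[OF P i0] le_trans by blast
    qed
    moreover have "\<not> is_star_packing {} {1..2::nat} (\<lambda>_. Suc 0) r L" for r :: "nat \<Rightarrow> 'a" and L
      by (rule no_two_stars_through_vertex) auto
    ultimately show ?thesis by (intro exI[of _ "\<lambda>_. Blue"]) simp
  qed
next
  case (Suc a G)
  then have finG: "finite G" by (simp add: simple_graph_def)
  let ?matching = "\<exists>M\<subseteq>G. card M = Suc (card I) \<and> (\<forall>e\<in>M. \<forall>f\<in>M. e \<noteq> f \<longrightarrow> e \<inter> f = {})"
  consider (no_forest) "\<nexists>r L. is_star_packing G I m r L" | (matching) ?matching
    | (no_matching) "\<exists>r L. is_star_packing G I m r L" "\<not> ?matching"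
    by argo
  then show ?case
  proof cases
    case no_forest
    have "\<not> is_star_packing {} {1..2::nat} (\<lambda>_. Suc (Suc a)) r L" for r :: "nat \<Rightarrow> 'a" and L
      by (rule no_two_stars_through_vertex) auto
    then show ?thesis using no_forest by (intro exI[of _ "\<lambda>_. Blue"]) simp
  next
    case matching
    then obtain M where M: "M \<subseteq> G" "card M = Suc (card I)"
      "\<And>e f. e \<in> M \<Longrightarrow> f \<in> M \<Longrightarrow> e \<noteq> f \<Longrightarrow> e \<inter> f = {}"
      by metis
    have "simple_graph (G - M)" using Suc.prems(1) by (simp add: simple_graph_def)
    moreover have "card (G - M) = card G - Suc (card I)"
      using M finG by (simp add: card_Diff_subset finite_subset)
    then have "card (G - M) < a + m i0 + (\<Sum>i\<in>I. a + m i)"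
      using Suc.prems(2) m[OF i0] by (simp add: sum_Suc sum.distrib)
    ultimately obtain c where
      red: "\<nexists>r L. is_star_packing {e \<in> G - M. c e = Red} {1..2::nat} (\<lambda>_. Suc a) r L" and
      blue: "\<nexists>r L. is_star_packing {e \<in> G - M. c e = Blue} I m r L"
      using Suc.IH by blast
    define c' where "c' e = (if e \<in> M then Red else c e)" for e
    have "{e \<in> G. c' e = Blue} = {e \<in> G - M. c e = Blue}"
      "{e \<in> G. c' e = Red} - M = {e \<in> G - M. c e = Red}"
      by (auto simp: c'_def)
    then show ?thesis
      using red blue is_star_packing_delete_matching[of "{e \<in> G. c' e = Red}" "{1..2::nat}"
          "\<lambda>_. Suc a" _ _ M] M(3)
      by (intro exI[of _ c']) metis
  next
    case no_matching
    from no_matching(1) obtain r L where P: "is_star_packing G I m r L" by blast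
    define c where "c e = (if r i0 \<in> e then Red else Blue)" for e
    have "\<not> is_star_packing {e \<in> G. c e = Red} {1..2::nat} (\<lambda>_. Suc (Suc a)) r' L'" for r' L'
      by (rule no_two_stars_through_vertex[where v = "r i0"]) (auto simp: c_def split: if_splits)
    moreover have "\<not> is_star_packing {e \<in> G. c e = Blue} I m r' L'" for r' L'
    proof
      assume Q: "is_star_packing {e \<in> G. c e = Blue} I m r' L'"
      \<comment> \<open>every blue star meets a root other than \<open>r i0\<close>, and the stars are disjoint\<close>
      have "\<exists>k\<in>I - {i0}. r k \<in> insert (r' i) (L' i)" if i: "i \<in> I" for i
      proof -
        note Qi = is_star_packingD[OF Q i]
        have "1 < card (L' i)" using Qi(2) m[OF i] by linarith
        then obtain p s where ps: "p \<in> L' i" "s \<in> L' i" "p \<noteq> s"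
          by (metis One_nat_def card_le_Suc0_iff_eq card.infinite linorder_not_le not_less_zero)
        then have "{r' i, p, s} \<inter> r ` I \<noteq> {}"
          using Qi(4) by (intro roots_meet_star_if_no_large_matching
              [OF Suc.prems(1) fin P m no_matching(2)]) auto
        moreover have "r i0 \<notin> {r' i, p, s}"
          using Qi(4)[OF ps(1)] Qi(4)[OF ps(2)] by (auto simp: c_def split: if_splits)
        ultimately show ?thesis using ps by fastforce
      qed
      then obtain g where g: "\<And>i. i \<in> I \<Longrightarrow> g i \<in> I - {i0} \<and> r (g i) \<in> insert (r' i) (L' i)"
        by metis
      have "inj_on g I"
        by (rule inj_onI) (metis g is_star_packing_disjoint[OF Q])
      then have "card I \<le> card (I - {i0})"
        using g fin by (intro card_inj_on_le[of g]) auto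
      then show False using card_Diff1_less[OF fin i0] by linarith
    qed
    ultimately show ?thesis by blast
  qed
qed

section \<open>The upper bound\<close>

lemma contains_copy_image:
  assumes "inj h" "contains_copy E F"
  shows "contains_copy ((`) h ` E) F"
proof -
  obtain f where f: "inj_on f (vertices F)" "\<forall>e\<in>F. f ` e \<in> E"
    using assms(2) by (auto simp: contains_copy_def)
  then have "inj_on (h \<circ> f) (vertices F)" "\<forall>e\<in>F. (h \<circ> f) ` e \<in> (`) h ` E"
    using assms(1) by (auto simp: image_comp[symmetric] intro: comp_inj_on inj_on_subset)
  then show ?thesis unfolding contains_copy_def by blast
qed

lemma arrows_image:
  assumes "inj h" "arrows G F1 F2"
  shows "arrows ((`) h ` G) F1 F2"
  unfolding arrows_def
proof
  fix c :: "'b set \<Rightarrow> colour"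
  have eq: "{e \<in> (`) h ` G. c e = x} = (`) h ` {e \<in> G. c (h ` e) = x}" for x by auto
  have "contains_copy {e \<in> G. c (h ` e) = Red} F1 \<or> contains_copy {e \<in> G. c (h ` e) = Blue} F2"
    using assms(2) unfolding arrows_def by (rule allE[of _ "\<lambda>e. c (h ` e)"])
  then show "contains_copy {e \<in> (`) h ` G. c e = Red} F1 \<or>
      contains_copy {e \<in> (`) h ` G. c e = Blue} F2"
    unfolding eq by (elim disj_forward contains_copy_image[OF assms(1)])
qed

lemma simple_graph_image:
  assumes "inj h" "simple_graph G"
  shows "simple_graph ((`) h ` G)"
  using assms by (auto simp: simple_graph_def card_image inj_on_subset)

text \<open>
  The star with index \<open>0\<close> is the additional one; it has as many edges as the star with index \<open>1\<close>.
\<close>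

lemma star_forest_arrows:
  fixes m :: "nat \<Rightarrow> nat"
  assumes m1: "\<And>i. i \<in> {1..t} \<Longrightarrow> m i \<le> m 1" "\<And>i. i \<in> {1..t} \<Longrightarrow> m i \<ge> 1"
  shows "arrows (disjoint_union {0..t} (\<lambda>i. star (a + m (max 1 i))))
           (disjoint_union {1..2::nat} (\<lambda>_. star (Suc a)))
           (disjoint_union {1..t} (\<lambda>i. star (m i)))"
    (is "arrows ?G ?F1 ?F2")
  unfolding arrows_def
proof
  fix c :: "(nat \<times> nat) set \<Rightarrow> colour"
  \<comment> \<open>\<open>K x i\<close> is the set of leaves joined to the \<open>i\<close>-th root by an edge of colour \<open>x\<close>\<close>
  define K where "K x i = {j \<in> {1..a + m (max 1 i)}. c {(i, 0), (i, j)} = x}" for x i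
  have finK: "finite (K x i)" for x i by (simp add: K_def)
  have sumK: "card (K Red i) + card (K Blue i) = a + m (max 1 i)" for i
  proof -
    have "K Red i \<union> K Blue i = {1..a + m (max 1 i)}"
      by (auto simp: K_def) (metis colour.exhaust)
    moreover have "K Red i \<inter> K Blue i = {}" by (auto simp: K_def)
    ultimately show ?thesis by (metis card_Un_disjoint card_atLeastAtMost diff_Suc_1 finK)
  qed
  have packing: "is_star_packing {e \<in> ?G. c e = x} I k (\<lambda>i. (s i, 0)) (\<lambda>i. Pair (s i) ` K x (s i))"
    if "inj_on s I" "\<And>i. i \<in> I \<Longrightarrow> s i \<le> t" "\<And>i. i \<in> I \<Longrightarrow> k i \<le> card (K x (s i))"
    for x and I :: "nat set" and k s
    unfolding is_star_packing_def
  proof (intro conjI ballI)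
    fix i assume i: "i \<in> I"
    show "finite (Pair (s i) ` K x (s i))" by (simp add: finK)
    show "k i \<le> card (Pair (s i) ` K x (s i))"
      using that(3)[OF i] by (simp add: card_image inj_on_def)
    show "(s i, 0) \<notin> Pair (s i) ` K x (s i)" by (auto simp: K_def)
    fix l assume "l \<in> Pair (s i) ` K x (s i)"
    then obtain j where j: "j \<in> {1..a + m (max 1 (s i))}" "l = (s i, j)" "c {(s i, 0), (s i, j)} = x"
      by (auto simp: K_def)
    have "{(s i, 0), l} \<in> ?G"
      unfolding j(2) using that(2)[OF i] j(1) by (intro edge_in_star_forest) auto
    then show "{(s i, 0), l} \<in> {e \<in> ?G. c e = x}" using j by simp
  next
    show "disjoint_family_on (\<lambda>i. insert (s i, 0) (Pair (s i) ` K x (s i))) I"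
      using that(1) by (auto simp: disjoint_family_on_def inj_on_def)
  qed
  show "contains_copy {e \<in> ?G. c e = Red} ?F1 \<or> contains_copy {e \<in> ?G. c e = Blue} ?F2"
  proof (cases "\<exists>i j. i \<le> t \<and> j \<le> t \<and> i \<noteq> j \<and> a < card (K Red i) \<and> a < card (K Red j)")
    case True
    then obtain i j where "i \<le> t" "j \<le> t" "i \<noteq> j" "a < card (K Red i)" "a < card (K Red j)"
      by blast
    then have "\<exists>r L. is_star_packing {e \<in> ?G. c e = Red} {1..2::nat} (\<lambda>_. Suc a) r L"
      by - (intro exI, rule packing[of "\<lambda>l. if l = 1 then i else j"], auto simp: inj_on_def)
    then show ?thesis by (simp add: contains_copy_star_forest_iff)
  next
    case False
    then obtain i1 where i1: "\<And>i. i \<le> t \<Longrightarrow> i \<noteq> i1 \<Longrightarrow> card (K Red i) \<le> a"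
      by (metis linorder_not_le)
    \<comment> \<open>the additional star replaces the exceptional one; nothing changes if \<open>i1 = 0\<close> or
      \<open>i1 > t\<close>\<close>
    define s where "s i = (if i = i1 then 0 else i)" for i
    have "m i \<le> card (K Blue (s i))" if i: "i \<in> {1..t}" for i
    proof -
      have "s i \<le> t" "s i \<noteq> i1" using i by (auto simp: s_def)
      then have "m (max 1 (s i)) \<le> card (K Blue (s i))" using i1[of "s i"] sumK[of "s i"] by simp
      moreover have "m i \<le> m (max 1 (s i))" using i m1(1)[OF i] by (auto simp: s_def max_def)
      ultimately show ?thesis by simp
    qed
    then have "\<exists>r L. is_star_packing {e \<in> ?G. c e = Blue} {1..t} m r L"
      by - (intro exI, rule packing[of s], auto simp: inj_on_def s_def split: if_splits)
    then show ?thesis using m1(2) by (subst (2) contains_copy_star_forest_iff) auto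
  qed
qed

lemma card_disjoint_union_star_le:
  assumes "finite I"
  shows "card (disjoint_union I (\<lambda>i. star (k i))) \<le> (\<Sum>i\<in>I. k i)"
proof -
  have "card ((`) (Pair i) ` star (k i)) \<le> k i" for i
    unfolding star_def image_image using card_image_le[of "{1..k i}"] by fastforce
  then show ?thesis
    unfolding disjoint_union_def by (rule order_trans[OF card_UN_le[OF assms] sum_mono])
qed

section \<open>The size Ramsey number\<close>

theorem theorem2p4:
  fixes n t :: nat and m :: "nat \<Rightarrow> nat"
  assumes "n \<ge> 1" and "t \<ge> 1"
    and "\<And>i j. 1 \<le> i \<Longrightarrow> i \<le> j \<Longrightarrow> j \<le> t \<Longrightarrow> m i \<ge> m j"
    and "m t \<ge> 2"
  shows "size_ramsey (disjoint_union {1..2::nat} (\<lambda>_. star n))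
                     (disjoint_union {1..t} (\<lambda>i. star (m i)))
         = n + m 1 - 1 + (\<Sum>i = 1..t. n + m i - 1)"
proof -
  obtain a where n: "n = Suc a" using assms(1) by (cases n) auto
  let ?F1 = "disjoint_union {1..2::nat} (\<lambda>_. star (Suc a))"
  let ?F2 = "disjoint_union {1..t} (\<lambda>i. star (m i))"
  let ?b = "a + m 1 + (\<Sum>i = 1..t. a + m i)"
  have m2: "m i \<ge> 2" if "i \<in> {1..t}" for i using assms(3)[of i t] assms(4) that by simp
  have lower: "?b \<le> card G" if G: "simple_graph G" "arrows G ?F1 ?F2" for G :: "nat set set"
  proof (rule ccontr)
    assume "\<not> ?b \<le> card G"
    then obtain c where
      "\<nexists>r L. is_star_packing {e \<in> G. c e = Red} {1..2::nat} (\<lambda>_. Suc a) r L"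
      "\<nexists>r L. is_star_packing {e \<in> G. c e = Blue} {1..t} m r L"
      using star_packing_free_colouring[OF G(1), of "{1..t}" 1 m a] m2 assms(2) by auto
    moreover have "contains_copy E ?F2 \<longleftrightarrow> (\<exists>r L. is_star_packing E {1..t} m r L)"
      for E :: "nat set set"
      using m2 by (intro contains_copy_star_forest_iff) fastforce
    moreover have "contains_copy E ?F1 \<longleftrightarrow> (\<exists>r L. is_star_packing E {1..2::nat} (\<lambda>_. Suc a) r L)"
      for E :: "nat set set"
      by (intro contains_copy_star_forest_iff) simp
    ultimately show False
      using G(2) unfolding arrows_def by blast
  qed
  define G0 where "G0 = disjoint_union {0..t} (\<lambda>i. star (a + m (max 1 i)))"
  define G where "G = (`) prod_encode ` G0"
  have "simple_graph G0"
    unfolding G0_def by (intro simple_graph_disjoint_union simple_graph_star) simp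
  then have sG: "simple_graph G"
    unfolding G_def by (intro simple_graph_image inj_prod_encode)
  have "arrows G0 ?F1 ?F2"
    unfolding G0_def
  proof (rule star_forest_arrows)
    fix i assume i: "i \<in> {1..t}"
    show "m i \<le> m 1" using assms(3)[of 1 i] i by simp
    show "1 \<le> m i" using m2[OF i] by simp
  qed
  then have aG: "arrows G ?F1 ?F2"
    unfolding G_def by (intro arrows_image inj_prod_encode)
  have "card G \<le> card G0"
    unfolding G_def using \<open>simple_graph G0\<close> by (intro card_image_le) (simp add: simple_graph_def)
  also have "\<dots> \<le> (\<Sum>i\<in>{0..t}. a + m (max 1 i))"
    unfolding G0_def by (rule card_disjoint_union_star_le) simp
  also have "\<dots> = ?b"
    by (simp add: sum.atLeast_Suc_atMost[of 0 t] max_def)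
  finally have "card G = ?b" using lower[OF sG aG] by simp
  then have "size_ramsey ?F1 ?F2 = ?b"
    unfolding size_ramsey_def using sG aG lower by (intro Least_equality) auto
  then show ?thesis by (simp add: n)
qed

end
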